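(* Let $v,\tau,\lambda$ be real numbers with $0<v<\tau<1$ and $\lambda\ge 1$. For distinct positive real numbers $a,b$ put $$M_{v,\tau;\lambda}(a,b)=\frac{A_v(a,b)^{\lambda}-H_v(a,b)^{\lambda}}{A_\tau(a,b)^{\lambda}-H_\tau(a,b)^{\lambda}}.$$ Then $$\left(\frac{v}{\tau}\right)^{\lambda}<M_{v,\tau;\lambda}(a,b)<\left(\frac{1-v}{1-\tau}\right)^{\lambda}$$ holds for all positive and distinct real numbers $a$ and $b$. Moreover, (for each fixed $b>0$) $\lim_{a\to 0}M_{v,\tau;\lambda}(a,b)=\left(\frac{1-v}{1-\tau}\right)^{\lambda}$, where $a\to 0$ through positive values, and $\lim_{a\to\infty}M_{v,\tau;\lambda}(a,b)=\left(\frac{v}{\tau}\right)^{\lambda}$.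
   Context: For $a,b>0$ and $0\le v\le 1$, the weighted arithmetic and harmonic means are $A_v(a,b)=va+(1-v)b$ and $H_v(a,b)=\left(va^{-1}+(1-v)b^{-1}\right)^{-1}$. *)

theory Defs
  imports "HOL-Analysis.Analysis"
begin

definition wam :: "real \<Rightarrow> real \<Rightarrow> real \<Rightarrow> real" where
  "wam v a b = v * a + (1 - v) * b"

definition whm :: "real \<Rightarrow> real \<Rightarrow> real \<Rightarrow> real" where
  "whm v a b = inverse (v * inverse a + (1 - v) * inverse b)"

text \<open>The quotient is only meant for positive \<open>a \<noteq> b\<close> and \<open>0 < \<tau> < 1\<close>, where the
  denominator is positive by the strict arithmetic-harmonic mean inequality.\<close>

definition mean_ratio :: "real \<Rightarrow> real \<Rightarrow> real \<Rightarrow> real \<Rightarrow> real \<Rightarrow> real" where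
  "mean_ratio v \<tau> l a b =
     (wam v a b powr l - whm v a b powr l) / (wam \<tau> a b powr l - whm \<tau> a b powr l)"

end

theory Submission
  imports Defs
begin

text \<open>Put \<open>x\<^sub>v = A\<^sub>v / v\<close> and \<open>y\<^sub>v = H\<^sub>v / v\<close>. Both \<open>x\<^sub>v\<close> and
  \<open>x\<^sub>v - y\<^sub>v = (1 - v) (a - b)\<^sup>2 / (v b + (1 - v) a)\<close> are strictly decreasing in \<open>v\<close>, so
  \<open>x\<^sub>v powr l - y\<^sub>v powr l\<close> is strictly decreasing too: if \<open>y\<^sub>v\<close> grows, by monotonicity of
  \<open>t powr l\<close>, otherwise by its convexity. This is the lower bound. The symmetry
  \<open>(v, a, b) \<mapsto> (1 - v, b, a)\<close> gives the upper bound, and together with homogeneity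
  it reduces the limit at infinity to the one at \<open>0\<close>.\<close>

text \<open>Convexity of \<open>t powr l\<close>: the difference has derivative
  \<open>l * ((t + d) powr (l - 1) - t powr (l - 1))\<close>, nonnegative since
  \<open>l - 1 \<ge> 0\<close>.\<close>

lemma powr_shift_diff_mono:
  fixes l d y z :: real
  assumes "1 \<le> l" "0 \<le> d" "0 < y" "y \<le> z"
  shows "(y + d) powr l - y powr l \<le> (z + d) powr l - z powr l"
proof (rule DERIV_nonneg_imp_nondecreasing[OF assms(4)])
  fix t assume t: "y \<le> t" "t \<le> z"
  have "((\<lambda>t. (t + d) powr l - t powr l) has_real_derivative
      l * (t + d) powr (l - 1) - l * t powr (l - 1)) (at t)"
    using t assms by (auto intro!: derivative_eq_intros)
  moreover have "l * t powr (l - 1) \<le> l * (t + d) powr (l - 1)"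
    using t assms by (intro mult_left_mono powr_mono2) auto
  ultimately show "\<exists>D. ((\<lambda>t. (t + d) powr l - t powr l) has_real_derivative D) (at t) \<and> 0 \<le> D"
    by force
qed

lemma powr_diff_strict_mono:
  fixes l x y X Y :: real
  assumes "1 \<le> l" "0 < y" "0 < Y" "Y \<le> X" "X < x" "X - Y < x - y"
  shows "X powr l - Y powr l < x powr l - y powr l"
proof (cases "y \<le> Y")
  case True
  then have "y powr l \<le> Y powr l" "X powr l < x powr l"
    using assms by (auto intro!: powr_mono2 powr_less_mono2)
  then show ?thesis by simp
next
  case False
  \<comment> \<open>Slide the interval from \<open>Y\<close> to \<open>X\<close> right until it
    starts at \<open>y\<close>. Its new right end \<open>y + (X - Y)\<close> is still below
    \<open>x\<close>, because \<open>X - Y < x - y\<close>.\<close>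
  have "X powr l - Y powr l \<le> (y + (X - Y)) powr l - y powr l"
    using powr_shift_diff_mono[of l "X - Y" Y y] assms False by simp
  also have "(y + (X - Y)) powr l < x powr l"
    using assms by (intro powr_less_mono2) auto
  finally show ?thesis by simp
qed

lemma wam_pos:
  assumes "0 < v" "v < 1" "0 < a" "0 < b"
  shows "0 < wam v a b"
  using assms by (simp add: wam_def add_pos_pos)

lemma whm_pos:
  assumes "0 < v" "v < 1" "0 < a" "0 < b"
  shows "0 < whm v a b"
  using assms by (simp add: whm_def add_pos_pos)

text \<open>Clears the inverses: the denominator \<open>wam v b a\<close> is affine in
  \<open>v\<close> and in \<open>a\<close>, and it stays nonzero at \<open>a = 0\<close> when
  \<open>v\<close> and \<open>b\<close> are positive.\<close>

lemma whm_eq: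
  assumes "0 < a" "0 < b"
  shows "whm v a b = a * b / wam v b a"
proof -
  have "v * inverse a + (1 - v) * inverse b = wam v b a / (a * b)"
    using assms by (simp add: wam_def field_simps)
  then show ?thesis by (simp add: whm_def)
qed

lemma wam_diff_whm:
  assumes "0 < v" "v < 1" "0 < a" "0 < b"
  shows "wam v a b - whm v a b = v * (1 - v) * (a - b)\<^sup>2 / wam v b a"
proof -
  have "wam v a b * wam v b a - a * b = v * (1 - v) * (a - b)\<^sup>2"
    by (simp add: wam_def) algebra
  then show ?thesis
    using wam_pos[of v b a] assms by (simp add: whm_eq field_simps)
qed

lemma whm_less_wam:
  assumes "0 < v" "v < 1" "0 < a" "0 < b" "a \<noteq> b"
  shows "whm v a b < wam v a b"
proof -
  have "0 < v * (1 - v) * (a - b)\<^sup>2 / wam v b a"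
    using assms wam_pos[of v b a] by simp
  then show ?thesis using wam_diff_whm[of v a b] assms by simp
qed

lemma wam_commute: "wam (1 - v) b a = wam v a b"
  by (simp add: wam_def)

lemma whm_commute: "whm (1 - v) b a = whm v a b"
  by (simp add: whm_def add.commute)

lemma mean_ratio_commute: "mean_ratio (1 - v) (1 - \<tau>) l b a = mean_ratio v \<tau> l a b"
  by (simp add: mean_ratio_def wam_commute whm_commute)

text \<open>Exchanging the weights exchanges numerator and denominator. A vanishing one is harmless,
  as \<open>inverse 0 = 0\<close>.\<close>

lemma mean_ratio_inverse: "mean_ratio \<tau> v l a b = inverse (mean_ratio v \<tau> l a b)"
  by (simp add: mean_ratio_def)

lemma wam_scale: "wam v (c * a) (c * b) = c * wam v a b"
  by (simp add: wam_def algebra_simps)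

lemma whm_scale: "whm v (c * a) (c * b) = c * whm v a b"
proof -
  have "v * inverse (c * a) + (1 - v) * inverse (c * b) =
      inverse c * (v * inverse a + (1 - v) * inverse b)"
    by (simp add: algebra_simps)
  then show ?thesis by (simp add: whm_def)
qed

lemma mean_ratio_scale:
  assumes "0 < v" "v < 1" "0 < \<tau>" "\<tau> < 1" "0 < a" "0 < b" "0 < c"
  shows "mean_ratio v \<tau> l (c * a) (c * b) = mean_ratio v \<tau> l a b"
proof -
  have "wam u (c * a) (c * b) powr l - whm u (c * a) (c * b) powr l =
      c powr l * (wam u a b powr l - whm u a b powr l)" if "0 < u" "u < 1" for u
    using wam_pos[of u a b] whm_pos[of u a b] that assms
    by (simp add: wam_scale whm_scale powr_mult right_diff_distrib)
  then show ?thesis using assms by (simp add: mean_ratio_def)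
qed

lemma mean_ratio_lower:
  assumes "0 < v" "v < \<tau>" "\<tau> < 1" "1 \<le> l" "0 < a" "0 < b" "a \<noteq> b"
  shows "(v / \<tau>) powr l < mean_ratio v \<tau> l a b"
proof -
  define x y where "x u = wam u a b / u" and "y u = whm u a b / u" for u
  have x_pos: "0 < x u" and y_pos: "0 < y u" and y_less: "y u < x u"
    and powr_diff: "wam u a b powr l - whm u a b powr l = u powr l * (x u powr l - y u powr l)"
    if "0 < u" "u < 1" for u
    using that assms wam_pos[of u a b] whm_pos[of u a b] whm_less_wam[of u a b]
    by (simp_all add: x_def y_def powr_divide divide_strict_right_mono right_diff_distrib)
  have x_less: "x \<tau> < x v"
  proof -
    \<comment> \<open>Only the term \<open>b / u\<close> depends on \<open>u\<close>.\<close>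
    have "x u = a + b / u - b" if "0 < u" for u
      using that by (simp add: x_def wam_def field_simps)
    moreover have "b / \<tau> < b / v"
      using assms by (intro divide_strict_left_mono) auto
    ultimately show ?thesis using assms by simp
  qed
  have "x \<tau> - y \<tau> < x v - y v"
  proof -
    have diff: "x u - y u = (a - b)\<^sup>2 * ((1 - u) / wam u b a)" if "0 < u" "u < 1" for u
    proof -
      have "x u - y u = (wam u a b - whm u a b) / u"
        by (simp add: x_def y_def diff_divide_distrib)
      then show ?thesis using that assms by (simp add: wam_diff_whm)
    qed
    \<comment> \<open>Cross-multiplied form of the claim that \<open>(1 - u) / wam u b a\<close>
      decreases in \<open>u\<close>: the terms in \<open>a\<close> cancel.\<close>
    have "(1 - v) * wam \<tau> b a - (1 - \<tau>) * wam v b a = (\<tau> - v) * b"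
      by (simp add: wam_def algebra_simps)
    moreover have "0 < (\<tau> - v) * b"
      using assms by simp
    ultimately have "(1 - \<tau>) * wam v b a < (1 - v) * wam \<tau> b a"
      by linarith
    then have "(1 - \<tau>) / wam \<tau> b a < (1 - v) / wam v b a"
      using assms wam_pos[of v b a] wam_pos[of \<tau> b a] by (simp add: divide_simps)
    then have "(a - b)\<^sup>2 * ((1 - \<tau>) / wam \<tau> b a) < (a - b)\<^sup>2 * ((1 - v) / wam v b a)"
      using assms by (intro mult_strict_left_mono) auto
    then show ?thesis using assms diff[of v] diff[of \<tau>] by simp
  qed
  then have less: "x \<tau> powr l - y \<tau> powr l < x v powr l - y v powr l"
    using powr_diff_strict_mono[of l "y v" "y \<tau>" "x \<tau>" "x v"] x_less assms
      y_pos[of v] y_pos[of \<tau>] y_less[of \<tau>] by simp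
  have pos: "0 < x \<tau> powr l - y \<tau> powr l"
    using assms y_pos[of \<tau>] y_less[of \<tau>] by (simp add: powr_less_mono2)
  \<comment> \<open>Extracting \<open>u powr l\<close> from numerator and denominator leaves a
    quotient that exceeds 1 by \<open>less\<close> and \<open>pos\<close>.\<close>
  have "mean_ratio v \<tau> l a b =
      (v / \<tau>) powr l * ((x v powr l - y v powr l) / (x \<tau> powr l - y \<tau> powr l))"
    using assms by (simp add: mean_ratio_def powr_diff powr_divide)
  moreover have "(v / \<tau>) powr l * 1 <
      (v / \<tau>) powr l * ((x v powr l - y v powr l) / (x \<tau> powr l - y \<tau> powr l))"
    using less pos assms by (intro mult_strict_left_mono) auto
  ultimately show ?thesis by simp
qed

text \<open>Since \<open>1 - \<tau> < 1 - v\<close>, the lower bound applies to the reflected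
  weights with \<open>a\<close> and \<open>b\<close> swapped. There it bounds the reciprocal of the
  ratio, and inverting positive quantities reverses the inequality.\<close>

lemma mean_ratio_upper:
  assumes "0 < v" "v < \<tau>" "\<tau> < 1" "1 \<le> l" "0 < a" "0 < b" "a \<noteq> b"
  shows "mean_ratio v \<tau> l a b < ((1 - v) / (1 - \<tau>)) powr l"
proof -
  have "((1 - \<tau>) / (1 - v)) powr l < mean_ratio (1 - \<tau>) (1 - v) l b a"
    using assms by (intro mean_ratio_lower) auto
  also have "\<dots> = inverse (mean_ratio v \<tau> l a b)"
    by (metis mean_ratio_commute mean_ratio_inverse)
  finally have "inverse (inverse (mean_ratio v \<tau> l a b)) < inverse (((1 - \<tau>) / (1 - v)) powr l)"
    using assms by (intro less_imp_inverse_less) auto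
  also have "\<dots> = ((1 - v) / (1 - \<tau>)) powr l"
    using assms by (simp add: powr_divide)
  finally show ?thesis by simp
qed

text \<open>The harmonic means vanish in the limit and the arithmetic ones tend to
  \<open>(1 - u) * b\<close>, so \<open>b powr l\<close> cancels.\<close>

lemma mean_ratio_tendsto_at_right_0:
  assumes "0 < v" "v < 1" "0 < \<tau>" "\<tau> < 1" "0 < l" "0 < b"
  shows "((\<lambda>a. mean_ratio v \<tau> l a b) \<longlongrightarrow> ((1 - v) / (1 - \<tau>)) powr l) (at_right 0)"
proof -
  have pos: "\<forall>\<^sub>F a :: real in at_right 0. 0 < a"
    by (rule eventually_at_right_less)
  have lim: "((\<lambda>a. wam u a b powr l - whm u a b powr l) \<longlongrightarrow> ((1 - u) * b) powr l) (at_right 0)"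
    if u: "0 < u" "u < 1" for u
  proof -
    have "((\<lambda>a. a * b / wam u b a) \<longlongrightarrow> 0 * b / (u * b + (1 - u) * 0)) (at_right 0)"
      unfolding wam_def using u assms by (intro tendsto_intros) auto
    moreover have "\<forall>\<^sub>F a in at_right 0. a * b / wam u b a = whm u a b"
      using pos by eventually_elim (simp add: whm_eq assms)
    ultimately have whm: "((\<lambda>a. whm u a b) \<longlongrightarrow> 0) (at_right 0)"
      using Lim_transform_eventually by force
    \<comment> \<open>The base tends to 0, so continuity of \<open>powr\<close> there requires a
      nonnegative base and \<open>l > 0\<close>.\<close>
    have "((\<lambda>a. whm u a b powr l) \<longlongrightarrow> 0 powr l) (at_right 0)"
      using u assms
      by (intro tendsto_powr2[OF whm tendsto_const])
        (auto intro!: eventually_mono[OF pos] less_imp_le whm_pos)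
    moreover have "((\<lambda>a. wam u a b powr l) \<longlongrightarrow> (u * 0 + (1 - u) * b) powr l) (at_right 0)"
      unfolding wam_def using u assms by (intro tendsto_intros) auto
    ultimately show ?thesis
      by (auto dest: tendsto_diff)
  qed
  have "((\<lambda>a. mean_ratio v \<tau> l a b) \<longlongrightarrow> ((1 - v) * b) powr l / ((1 - \<tau>) * b) powr l) (at_right 0)"
    unfolding mean_ratio_def using assms by (intro tendsto_divide lim) auto
  then show ?thesis
    using assms by (simp add: powr_mult powr_divide)
qed

lemma mean_ratio_tendsto_at_top:
  assumes "0 < v" "v < 1" "0 < \<tau>" "\<tau> < 1" "0 < l" "0 < b"
  shows "((\<lambda>a. mean_ratio v \<tau> l a b) \<longlongrightarrow> (v / \<tau>) powr l) at_top"
proof -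
  have lim: "((\<lambda>t. mean_ratio (1 - v) (1 - \<tau>) l t b) \<longlongrightarrow> (v / \<tau>) powr l) (at_right 0)"
    using mean_ratio_tendsto_at_right_0[of "1 - v" "1 - \<tau>" l b] assms by simp
  have "((\<lambda>a. b * b * inverse a) \<longlongrightarrow> b * b * 0) at_top"
    by (intro tendsto_intros tendsto_inverse_0_at_top filterlim_ident)
  moreover have "\<forall>\<^sub>F a in at_top. 0 < b * b * inverse a"
    using eventually_gt_at_top[of 0] by eventually_elim (use assms in simp)
  \<comment> \<open>The limit at 0 is one-sided, so the substituted argument must approach 0 through
    positive values.\<close>
  ultimately have "filterlim (\<lambda>a. b * b * inverse a) (at_right 0) at_top"
    by (intro tendsto_imp_filterlim_at_right) auto
  from filterlim_compose[OF lim this] show ?thesis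
  proof (rule Lim_transform_eventually)
    show "\<forall>\<^sub>F a in at_top. mean_ratio (1 - v) (1 - \<tau>) l (b * b * inverse a) b = mean_ratio v \<tau> l a b"
      using eventually_gt_at_top[of 0]
    proof eventually_elim
      case (elim a)
      \<comment> \<open>The factor \<open>b / a\<close> restores the second argument to the fixed
        \<open>b\<close> and makes the first one \<open>b * b / a\<close>, which tends to 0.\<close>
      have "mean_ratio (1 - v) (1 - \<tau>) l ((b / a) * b) ((b / a) * a) =
          mean_ratio (1 - v) (1 - \<tau>) l b a"
        using assms elim by (intro mean_ratio_scale) auto
      moreover have "b / a * a = b" "b / a * b = b * b * inverse a"
        using elim by (simp_all add: divide_inverse)
      ultimately show ?case by (simp only: mean_ratio_commute)
    qed
  qed
qed

theorem theorem2p1: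
  fixes v \<tau> l :: real
  assumes "0 < v" and "v < \<tau>" and "\<tau> < 1" and "1 \<le> l"
  shows "(\<forall>a b. 0 < a \<longrightarrow> 0 < b \<longrightarrow> a \<noteq> b \<longrightarrow>
            (v / \<tau>) powr l < mean_ratio v \<tau> l a b \<and>
            mean_ratio v \<tau> l a b < ((1 - v) / (1 - \<tau>)) powr l)
       \<and> (\<forall>b>0. ((\<lambda>a. mean_ratio v \<tau> l a b) \<longlongrightarrow> ((1 - v) / (1 - \<tau>)) powr l) (at_right 0))
       \<and> (\<forall>b>0. ((\<lambda>a. mean_ratio v \<tau> l a b) \<longlongrightarrow> (v / \<tau>) powr l) at_top)"
  using assms
  by (simp add: mean_ratio_lower mean_ratio_upper
      mean_ratio_tendsto_at_right_0 mean_ratio_tendsto_at_top)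

end
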